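(* Let $s<n$ be integers, $X=\{x\in\mathbb{R}^n: g(x)\le0,\ h(x)=0\}$ with $g_i$, $i=1,\dots,m$, convex and continuously differentiable and $h_i$, $i=1,\dots,p$, affine, and $f:\mathbb{R}^n\to\mathbb{R}$ continuously differentiable with Lipschitz continuous gradient on $\mathbb{R}^n$. Assume the KKT property stated in the context. Let $\mathcal{N}$ be a discrete neighborhood map satisfying the continuity property. Let $\{(x^k,y^k)\}$ be the sequence generated by Algorithm SNS (with neighborhood $\mathcal{N}$) from $y^0\in\mathcal{Y}$, $x^0\in\mathcal{X}(y^0)$ with parameter $\xi>0$, and suppose that the level set $\{(x,y): y\in\mathcal{Y},\ x\in\mathcal{X}(y),\ f(x)\le f(x^0)+\xi\}$ is compact. Let $K_u=\{k\ge 1:\eta_k<\eta_{k-1}\}$. Then for every accumulation point $(x^*,y^* )$ of $\{(x^k,y^k)\}_{k\in K_u}$ there exist multipliers $\lambda\in\mathbb{R}^m$, $\mu\in\mathbb{R}^p$, $\gamma\in\mathbb{R}^n$ such that $$\nabla f(x^* )+\sum_{i=1}^m\lambda_i\nabla g_i(x^* )+\sum_{i=1}^p\mu_i\nabla h_i(x^* )+\sum_{i=1}^n\gamma_ie_i=0,$$ $\lambda_i\ge0$ and $\lambda_ig_i(x^* )=0$ for all $i=1,\dots,m$, and $\gamma_i=0$ for all $i$ such that $y^*_i=0$.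
   Context: $\|x\|_0$ is the number of nonzero components of $x$, $e$ is the all-ones vector, $e_i$ is the $i$-th standard unit vector, $\Pi_C$ is the Euclidean projection onto a nonempty closed convex set $C$. Put $\mathcal{Y}=\{y\in\{0,1\}^n : e^\top y\ge n-s\}$ and $\mathcal{X}(y)=\{x\in X : x_iy_i=0\ \forall i\}$ for $y\in\mathcal{Y}$ (closed and convex). A pair $(x,y)$ is feasible if $y\in\mathcal{Y}$ and $x\in\mathcal{X}(y)$. A sequence $(x^k,y^k)$ converges to $(\bar x,\bar y)$ if $x^k\to\bar x$ and $y^k=\bar y$ for all sufficiently large $k$; accumulation points are limits of convergent subsequences. Stationarity: $\bar x\in\mathcal{X}(\bar y)$ is a stationary point of $\min\{f(x):x\in\mathcal{X}(\bar y)\}$ if $\bar x=\Pi_{\mathcal{X}(\bar y)}[\bar x-\nabla f(\bar x)]$. KKT property: for every $\bar y\in\mathcal{Y}$ and $\bar x\in\mathcal{X}(\bar y)$, $\bar x$ is a stationary point of $\min\{f(x):x\in\mathcal{X}(\bar y)\}$ if and only if there exist $\lambda\in\mathbb{R}^m$, $\mu\in\mathbb{R}^p$, $\gamma\in\mathbb{R}^n$ with $\nabla f(\bar x)+\sum_{i=1}^m\lambda_i\nabla g_i(\bar x)+\sum_{i=1}^p\mu_i\nabla h_i(\bar x)+\sum_{i=1}^n\gamma_ie_i=0$, $\lambda_i\ge0$ and $\lambda_ig_i(\bar x)=0$ for all $i=1,\dots,m$, and $\gamma_i=0$ for all $i$ with $\bar y_i=0$. A discrete neighborhood map $\mathcal{N}$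 assigns to every feasible pair $(x,y)$ a finite set $\mathcal{N}(x,y)$ of feasible pairs containing $(x,y)$. Continuity property: whenever a sequence of feasible pairs $(x^k,y^k)$ converges to $(\bar x,\bar y)$, for every $(\hat x,\hat y)\in\mathcal{N}(\bar x,\bar y)$ there is a sequence $(\hat x^k,\hat y^k)\in\mathcal{N}(x^k,y^k)$ converging to $(\hat x,\hat y)$. Procedure PGLS$(x,y)$ (fixed constants $\gamma\in(0,\tfrac12)$, $\delta\in(0,1)$): for a feasible pair $(x,y)$ set $d=\Pi_{\mathcal{X}(y)}[x-\nabla f(x)]-x$; let $\alpha$ be the first element of $1,\delta,\delta^2,\dots$ with $f(x+\alpha d)\le f(x)+\gamma\alpha\nabla f(x)^\top d$; return $\tilde x=x+\alpha d$. (This scalar $\gamma$ is unrelated to the multiplier vector $\gamma$.) Algorithm SNS. Inputs: $y^0\in\mathcal{Y}$, $x^0\in\mathcal{X}(y^0)$, $\xi>0$, $\theta\in(0,1)$, $\eta_0>0$, $\mu_0>0$, $\delta'\in(0,1)$. For $k=0,1,2,\dots$ (no stopping rule): Step 1: compute $\tilde x^k$ by PGLS$(x^k,y^k)$. Step 2: let $W_k=\{(x,y)\in\mathcal{N}(\tilde x^k,y^k): f(x)\le f(\tilde x^k)+\xi\}$. 2.1: if $W_k\ne\emptyset$, choose any $(x',y')\in W_k$, set $j=1$, $x^j=x'$ (inner iterates); otherwise go to Step 3. 2.2: compute $x^{j+1}$ by PGLS$(x^j,y')$. 2.3: if $f(x^{j+1})\le f(\tilde x^k)-\eta_k$, set $x^{k+1}=x^{j+1}$,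 $y^{k+1}=y'$, $\eta_{k+1}=\eta_k$ and go to Step 4. 2.4: if $\|x^j-\Pi_{\mathcal{X}(y')}[x^j-\nabla f(x^j)]\|>\|x^k-\Pi_{\mathcal{X}(y^k)}[x^k-\nabla f(x^k)]\|+\mu_k$, set $j=j+1$ and go to 2.2; otherwise remove $(x',y')$ from $W_k$ and go to 2.1. Step 3: set $x^{k+1}=\tilde x^k$, $y^{k+1}=y^k$; if $f(x^{k+1})\le f(x^k)-\eta_k$ set $\eta_{k+1}=\eta_k$, otherwise $\eta_{k+1}=\theta\eta_k$. Step 4: set $\mu_{k+1}=\delta'\mu_k$ and pass to iteration $k+1$. *)

theory Defs
  imports "HOL-Analysis.Analysis"
begin

section \<open>Gradients\<close>

definition grad :: "('a::real_inner \<Rightarrow> real) \<Rightarrow> 'a \<Rightarrow> 'a" where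
  "grad f x = (THE d. GDERIV f x :> d)"

lemma GDERIV_unique_real_inner:
  assumes "GDERIV f x :> d" "GDERIV f x :> d'"
  shows "d = d'"
proof -
  have "(\<lambda>h. h \<bullet> d) = (\<lambda>h. h \<bullet> d')"
    using assms unfolding gderiv_def by (rule has_derivative_unique)
  then show ?thesis
    by (metis vector_eq_ldot inner_commute)
qed

lemma grad_eqI: "GDERIV f x :> d \<Longrightarrow> grad f x = d"
  unfolding grad_def using GDERIV_unique_real_inner by blast

definition continuously_differentiable :: "('a::real_inner \<Rightarrow> real) \<Rightarrow> bool" where
  "continuously_differentiable f \<longleftrightarrow>
     (\<forall>x. GDERIV f x :> grad f x) \<and> continuous_on UNIV (grad f)"

definition affine_fun :: "('a::real_inner \<Rightarrow> real) \<Rightarrow> bool" where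
  "affine_fun h \<longleftrightarrow> (\<exists>a b. \<forall>x. h x = a \<bullet> x + b)"

section \<open>Feasible pairs\<close>

text \<open>The constraint families are indexed by \<open>1, \<dots>, m\<close> and \<open>1, \<dots>, p\<close>; values at
  other indices are irrelevant, and \<open>m = 0\<close> or \<open>p = 0\<close> is allowed.\<close>

definition constraint_set ::
    "nat \<Rightarrow> (nat \<Rightarrow> real^'n \<Rightarrow> real) \<Rightarrow> nat \<Rightarrow> (nat \<Rightarrow> real^'n \<Rightarrow> real) \<Rightarrow> (real^'n) set" where
  "constraint_set m g p h =
     {x. (\<forall>i\<in>{1..m}. g i x \<le> 0) \<and> (\<forall>i\<in>{1..p}. h i x = 0)}"

text \<open>Here \<open>1 :: real^'n\<close> is the all-ones vector \<open>e\<close>.\<close>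

definition Yset :: "int \<Rightarrow> (real^'n) set" where
  "Yset s = {y. (\<forall>i. y $ i \<in> {0, 1}) \<and> 1 \<bullet> y \<ge> real CARD('n) - real_of_int s}"

definition Xset :: "(real^'n) set \<Rightarrow> real^'n \<Rightarrow> (real^'n) set" where
  "Xset X y = {x \<in> X. \<forall>i. x $ i * y $ i = 0}"

definition feasible_pairs :: "(real^'n) set \<Rightarrow> int \<Rightarrow> ((real^'n) \<times> (real^'n)) set" where
  "feasible_pairs X s = {(x, y). y \<in> Yset s \<and> x \<in> Xset X y}"

definition pair_converges ::
    "(nat \<Rightarrow> (real^'n) \<times> (real^'n)) \<Rightarrow> (real^'n) \<times> (real^'n) \<Rightarrow> bool" where
  "pair_converges z zb \<longleftrightarrow>
     (\<lambda>k. fst (z k)) \<longlonglongrightarrow> fst zb \<and> (\<forall>\<^sub>F k in sequentially. snd (z k) = snd zb)"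

definition accumulation_point_along ::
    "nat set \<Rightarrow> (nat \<Rightarrow> (real^'n) \<times> (real^'n)) \<Rightarrow> (real^'n) \<times> (real^'n) \<Rightarrow> bool" where
  "accumulation_point_along K z zb \<longleftrightarrow>
     (\<exists>r. strict_mono r \<and> range r \<subseteq> K \<and> pair_converges (z \<circ> r) zb)"

section \<open>Stationarity and multipliers\<close>

definition stationary :: "('a::euclidean_space \<Rightarrow> real) \<Rightarrow> 'a set \<Rightarrow> 'a \<Rightarrow> bool" where
  "stationary f C x \<longleftrightarrow> x \<in> C \<and> x = closest_point C (x - grad f x)"

definition KKT_multipliers ::
    "(real^'n \<Rightarrow> real) \<Rightarrow> nat \<Rightarrow> (nat \<Rightarrow> real^'n \<Rightarrow> real) \<Rightarrow> nat \<Rightarrow> (nat \<Rightarrow> real^'n \<Rightarrow> real)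
     \<Rightarrow> real^'n \<Rightarrow> real^'n \<Rightarrow> (nat \<Rightarrow> real) \<Rightarrow> (nat \<Rightarrow> real) \<Rightarrow> real^'n \<Rightarrow> bool" where
  "KKT_multipliers f m g p h x y lam mu gam \<longleftrightarrow>
     grad f x + (\<Sum>i=1..m. lam i *\<^sub>R grad (g i) x) + (\<Sum>i=1..p. mu i *\<^sub>R grad (h i) x)
       + (\<Sum>i\<in>UNIV. (gam $ i) *\<^sub>R axis i 1) = 0
     \<and> (\<forall>i\<in>{1..m}. lam i \<ge> 0 \<and> lam i * g i x = 0)
     \<and> (\<forall>i. y $ i = 0 \<longrightarrow> gam $ i = 0)"

definition KKT_property ::
    "(real^'n \<Rightarrow> real) \<Rightarrow> nat \<Rightarrow> (nat \<Rightarrow> real^'n \<Rightarrow> real) \<Rightarrow> nat \<Rightarrow> (nat \<Rightarrow> real^'n \<Rightarrow> real)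
     \<Rightarrow> int \<Rightarrow> bool" where
  "KKT_property f m g p h s \<longleftrightarrow>
     (\<forall>y\<in>Yset s. \<forall>x\<in>Xset (constraint_set m g p h) y.
        stationary f (Xset (constraint_set m g p h) y) x \<longleftrightarrow>
        (\<exists>lam mu gam. KKT_multipliers f m g p h x y lam mu gam))"

section \<open>Discrete neighborhoods\<close>

text \<open>Only the values of \<open>N\<close> at feasible pairs matter.\<close>

definition discrete_neighborhood_map ::
    "(real^'n) set \<Rightarrow> int \<Rightarrow> ((real^'n) \<times> (real^'n) \<Rightarrow> ((real^'n) \<times> (real^'n)) set) \<Rightarrow> bool" where
  "discrete_neighborhood_map X s N \<longleftrightarrow>
     (\<forall>z\<in>feasible_pairs X s. finite (N z) \<and> N z \<subseteq> feasible_pairs X s \<and> z \<in> N z)"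

definition neighborhood_continuous ::
    "(real^'n) set \<Rightarrow> int \<Rightarrow> ((real^'n) \<times> (real^'n) \<Rightarrow> ((real^'n) \<times> (real^'n)) set) \<Rightarrow> bool" where
  "neighborhood_continuous X s N \<longleftrightarrow>
     (\<forall>z zb. (\<forall>k. z k \<in> feasible_pairs X s) \<and> pair_converges z zb \<longrightarrow>
        (\<forall>zh\<in>N zb. \<exists>w. (\<forall>k. w k \<in> N (z k)) \<and> pair_converges w zh))"

section \<open>Projected gradient with line search\<close>

definition PG_direction :: "('a::euclidean_space \<Rightarrow> real) \<Rightarrow> 'a set \<Rightarrow> 'a \<Rightarrow> 'a" where
  "PG_direction f C x = closest_point C (x - grad f x) - x"

text \<open>\<open>\<gamma>\<close> is the sufficient-decrease constant and \<open>\<delta>\<close> the backtracking factor; \<open>C\<close> is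
  \<open>Xset X y\<close> in all uses below.\<close>

definition PGLS :: "('a::euclidean_space \<Rightarrow> real) \<Rightarrow> real \<Rightarrow> real \<Rightarrow> 'a set \<Rightarrow> 'a \<Rightarrow> 'a" where
  "PGLS f \<gamma> \<delta> C x =
     (let d = PG_direction f C x;
          \<alpha> = \<delta> ^ (LEAST i. f (x + \<delta> ^ i *\<^sub>R d) \<le> f x + \<gamma> * \<delta> ^ i * (grad f x \<bullet> d))
      in x + \<alpha> *\<^sub>R d)"

definition residual :: "('a::euclidean_space \<Rightarrow> real) \<Rightarrow> 'a set \<Rightarrow> 'a \<Rightarrow> real" where
  "residual f C x = norm (x - closest_point C (x - grad f x))"

section \<open>Algorithm SNS\<close>

text \<open>Steps 2.2--2.4 for one selected pair, with \<open>P\<close> the map \<open>x\<^sup>j \<mapsto> x\<^sup>j\<^sup>+\<^sup>1\<close>, \<open>res\<close> the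
  residual on the set of the selected pair, \<open>t\<close> the acceptance level of Step 2.3 and \<open>\<rho>\<close> the
  residual bound of Step 2.4.  The result is \<open>Some x\<^sup>j\<^sup>+\<^sup>1\<close> if Step 2.3 succeeds and \<open>None\<close> if
  the pair is discarded; a non-terminating inner loop has no result.\<close>

inductive inner_loop ::
    "('a \<Rightarrow> real) \<Rightarrow> ('a \<Rightarrow> 'a) \<Rightarrow> ('a \<Rightarrow> real) \<Rightarrow> real \<Rightarrow> real \<Rightarrow> 'a \<Rightarrow> 'a option \<Rightarrow> bool"
  for f :: "'a \<Rightarrow> real" and P :: "'a \<Rightarrow> 'a" and res :: "'a \<Rightarrow> real" and t \<rho> :: real where
  accept: "f (P x) \<le> t \<Longrightarrow> inner_loop f P res t \<rho> x (Some (P x))"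
| continue: "\<lbrakk>\<not> f (P x) \<le> t; res x > \<rho>; inner_loop f P res t \<rho> (P x) r\<rbrakk>
    \<Longrightarrow> inner_loop f P res t \<rho> x r"
| discard: "\<lbrakk>\<not> f (P x) \<le> t; \<not> res x > \<rho>\<rbrakk> \<Longrightarrow> inner_loop f P res t \<rho> x None"

text \<open>Step 2 as a whole: elements of the set \<open>W\<close> are chosen in an arbitrary order until one is
  accepted (result \<open>Some\<close> of the new pair) or \<open>W\<close> is exhausted (result \<open>None\<close>).\<close>

inductive local_search ::
    "(real^'n \<Rightarrow> real) \<Rightarrow> (real^'n) set \<Rightarrow> real \<Rightarrow> real \<Rightarrow> real \<Rightarrow> real
     \<Rightarrow> ((real^'n) \<times> (real^'n)) set \<Rightarrow> ((real^'n) \<times> (real^'n)) option \<Rightarrow> bool"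
  for f :: "real^'n \<Rightarrow> real" and X :: "(real^'n) set" and \<gamma> \<delta> t \<rho> :: real where
  exhausted: "local_search f X \<gamma> \<delta> t \<rho> {} None"
| found: "\<lbrakk>(x', y') \<in> W;
      inner_loop f (PGLS f \<gamma> \<delta> (Xset X y')) (residual f (Xset X y')) t \<rho> x' (Some x'')\<rbrakk>
    \<Longrightarrow> local_search f X \<gamma> \<delta> t \<rho> W (Some (x'', y'))"
| removed: "\<lbrakk>(x', y') \<in> W;
      inner_loop f (PGLS f \<gamma> \<delta> (Xset X y')) (residual f (Xset X y')) t \<rho> x' None;
      local_search f X \<gamma> \<delta> t \<rho> (W - {(x', y')}) r\<rbrakk>
    \<Longrightarrow> local_search f X \<gamma> \<delta> t \<rho> W r"

text \<open>One outer iteration, from \<open>(x, y, \<eta>, \<mu>)\<close> to \<open>(x1, y1, \<eta>1, \<mu>1)\<close>.\<close>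

definition SNS_step ::
    "(real^'n \<Rightarrow> real) \<Rightarrow> (real^'n) set \<Rightarrow> ((real^'n) \<times> (real^'n) \<Rightarrow> ((real^'n) \<times> (real^'n)) set)
     \<Rightarrow> real \<Rightarrow> real \<Rightarrow> real \<Rightarrow> real \<Rightarrow> real
     \<Rightarrow> real^'n \<Rightarrow> real^'n \<Rightarrow> real \<Rightarrow> real \<Rightarrow> real^'n \<Rightarrow> real^'n \<Rightarrow> real \<Rightarrow> real \<Rightarrow> bool" where
  "SNS_step f X N \<gamma> \<delta> \<xi> \<theta> \<delta>' x y \<eta> \<mu> x1 y1 \<eta>1 \<mu>1 \<longleftrightarrow>
     (let xt = PGLS f \<gamma> \<delta> (Xset X y) x;
          W = {(u, v) \<in> N (xt, y). f u \<le> f xt + \<xi>}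
      in (\<exists>r. local_search f X \<gamma> \<delta> (f xt - \<eta>) (residual f (Xset X y) x + \<mu>) W r \<and>
            (case r of
               Some (x'', y') \<Rightarrow> x1 = x'' \<and> y1 = y' \<and> \<eta>1 = \<eta>
             | None \<Rightarrow> x1 = xt \<and> y1 = y \<and>
                 \<eta>1 = (if f x1 \<le> f x - \<eta> then \<eta> else \<theta> * \<eta>)))
         \<and> \<mu>1 = \<delta>' * \<mu>)"

definition SNS_sequence ::
    "(real^'n \<Rightarrow> real) \<Rightarrow> (real^'n) set \<Rightarrow> ((real^'n) \<times> (real^'n) \<Rightarrow> ((real^'n) \<times> (real^'n)) set)
     \<Rightarrow> real \<Rightarrow> real \<Rightarrow> real \<Rightarrow> real \<Rightarrow> real
     \<Rightarrow> (nat \<Rightarrow> real^'n) \<Rightarrow> (nat \<Rightarrow> real^'n) \<Rightarrow> (nat \<Rightarrow> real) \<Rightarrow> (nat \<Rightarrow> real) \<Rightarrow> bool" where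
  "SNS_sequence f X N \<gamma> \<delta> \<xi> \<theta> \<delta>' x y \<eta> \<mu> \<longleftrightarrow>
     (\<forall>k. SNS_step f X N \<gamma> \<delta> \<xi> \<theta> \<delta>' (x k) (y k) (\<eta> k) (\<mu> k)
            (x (Suc k)) (y (Suc k)) (\<eta> (Suc k)) (\<mu> (Suc k)))"

end

theory Submission
  imports Defs
begin

text \<open>If \<open>\<eta>\<close> is reduced in passing to iteration \<open>k\<close>, then \<open>x\<^sup>k\<close> is the projected gradient step
  from \<open>x\<^sup>k\<^sup>-\<^sup>1\<close> on the unchanged set \<open>\<X>(y\<^sup>k\<^sup>-\<^sup>1)\<close>, and it decreases \<open>f\<close> by less than \<open>\<eta>\<^sub>k\<^sub>-\<^sub>1\<close>.  Because
  \<open>\<nabla>f\<close> is Lipschitz, the line search step sizes are bounded away from zero, so this decrease is at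
  least a fixed multiple of the squared residual at \<open>x\<^sup>k\<^sup>-\<^sup>1\<close>.  There are infinitely many reductions,
  hence \<open>\<eta>\<^sub>k \<rightarrow> 0\<close>; so the residuals at \<open>x\<^sup>k\<^sup>-\<^sup>1\<close> tend to zero along \<open>K\<^sub>u\<close>, and \<open>x\<^sup>k\<^sup>-\<^sup>1\<close> and \<open>x\<^sup>k\<close> have
  the same accumulation points.  By continuity of the projection these are stationary.\<close>

section \<open>Closedness and convexity of the feasible sets\<close>

lemma closed_Xset:
  fixes X :: "(real^'n) set"
  assumes "closed X"
  shows "closed (Xset X y)"
proof -
  have "Xset X y = X \<inter> (\<Inter>i. {x. x $ i * y $ i = 0})"
    by (auto simp: Xset_def)
  then show ?thesis
    using assms
    by (simp only:) (intro closed_Int closed_INT ballI closed_Collect_eq continuous_intros)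
qed

lemma convex_Xset:
  fixes X :: "(real^'n) set"
  assumes "convex X"
  shows "convex (Xset X y)"
proof (rule convexI)
  fix u v :: "real^'n" and a b :: real
  assume uv: "u \<in> Xset X y" "v \<in> Xset X y" and ab: "0 \<le> a" "0 \<le> b" "a + b = 1"
  then have "a *\<^sub>R u + b *\<^sub>R v \<in> X"
    using assms by (auto simp: Xset_def intro: convexD)
  moreover have "(a *\<^sub>R u + b *\<^sub>R v) $ i * y $ i = 0" for i
  proof -
    have "u $ i * y $ i = 0" "v $ i * y $ i = 0"
      using uv unfolding Xset_def by blast+
    then show ?thesis
      by (auto simp: distrib_right mult.assoc)
  qed
  ultimately show "a *\<^sub>R u + b *\<^sub>R v \<in> Xset X y"
    by (simp add: Xset_def)
qed

lemma constraint_set_eq: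
  "constraint_set m g p h =
     (\<Inter>i\<in>{1..m}. {x. g i x \<le> 0}) \<inter> (\<Inter>i\<in>{1..p}. {x. h i x = 0})"
  by (auto simp: constraint_set_def)

lemma closed_constraint_set:
  assumes g: "\<And>i. i \<in> {1..m} \<Longrightarrow> continuously_differentiable (g i)"
    and h: "\<And>i. i \<in> {1..p} \<Longrightarrow> affine_fun (h i)"
  shows "closed (constraint_set m g p h)"
proof -
  have "closed {x. g i x \<le> 0}" if "i \<in> {1..m}" for i
  proof -
    have "continuous_on UNIV (g i)"
      using g[OF that] unfolding continuously_differentiable_def gderiv_def
      by (meson continuous_at_imp_continuous_on has_derivative_continuous)
    then show ?thesis
      by (intro closed_Collect_le continuous_intros)
  qed
  moreover have "closed {x. h i x = 0}" if i: "i \<in> {1..p}" for i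
  proof -
    from h[OF i] obtain a b where "\<And>x. h i x = a \<bullet> x + b"
      unfolding affine_fun_def by blast
    then show ?thesis
      by (auto intro!: closed_Collect_eq continuous_intros)
  qed
  ultimately show ?thesis
    unfolding constraint_set_eq by (intro closed_Int closed_INT ballI) auto
qed

lemma convex_constraint_set:
  fixes g h :: "nat \<Rightarrow> real^'n \<Rightarrow> real"
  assumes g: "\<And>i. i \<in> {1..m} \<Longrightarrow> convex_on UNIV (g i)"
    and h: "\<And>i. i \<in> {1..p} \<Longrightarrow> affine_fun (h i)"
  shows "convex (constraint_set m g p h)"
proof -
  have "convex {x. g i x \<le> 0}" if i: "i \<in> {1..m}" for i
  proof (rule convexI)
    fix u v :: "real^'n" and a b :: real
    assume uv: "u \<in> {x. g i x \<le> 0}" "v \<in> {x. g i x \<le> 0}" and ab: "0 \<le> a" "0 \<le> b" "a + b = 1"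
    have "g i (a *\<^sub>R u + b *\<^sub>R v) \<le> a * g i u + b * g i v"
      using g[OF i] ab by (auto simp: convex_on_def)
    also have "\<dots> \<le> 0"
      using uv ab by (simp add: add_nonpos_nonpos mult_nonneg_nonpos)
    finally show "a *\<^sub>R u + b *\<^sub>R v \<in> {x. g i x \<le> 0}" by simp
  qed
  moreover have "convex {x. h i x = 0}" if i: "i \<in> {1..p}" for i
  proof -
    from h[OF i] obtain a b where "\<And>x. h i x = a \<bullet> x + b"
      unfolding affine_fun_def by blast
    then have "{x. h i x = 0} = {x. a \<bullet> x = - b}"
      by (auto simp: eq_neg_iff_add_eq_0)
    then show ?thesis
      by (simp add: convex_hyperplane)
  qed
  ultimately show ?thesis
    unfolding constraint_set_eq by (intro convex_Int convex_INT) auto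
qed

section \<open>Projected gradient steps and the line search\<close>

lemma residual_eq_norm_PG_direction: "residual f C x = norm (PG_direction f C x)"
  by (simp add: residual_def PG_direction_def norm_minus_commute)

text \<open>This is the variational inequality for the projection of \<open>x - grad f x\<close>,
  tested with the point \<open>x\<close> of \<open>C\<close> itself.\<close>

lemma grad_inner_PG_direction_le:
  assumes "convex C" "closed C" "x \<in> C"
  shows "grad f x \<bullet> PG_direction f C x \<le> - (norm (PG_direction f C x))\<^sup>2"
  using closest_point_dot[OF assms, of "x - grad f x"]
  unfolding PG_direction_def power2_norm_eq_inner
  by (simp add: inner_diff_left inner_diff_right inner_commute)

text \<open>The mean value theorem along the segment replaces the gradient at \<open>x\<close> by
  one at an intermediate point, and these differ by at most \<open>L * norm d\<close>. Integrating
  along the segment would give \<open>L / 2\<close> in place of \<open>L\<close>.\<close>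

lemma Lipschitz_grad_upper_bound:
  assumes f: "continuously_differentiable f" and L: "L-lipschitz_on UNIV (grad f)"
  shows "f (x + d) \<le> f x + grad f x \<bullet> d + L * (norm d)\<^sup>2"
proof -
  have "((\<lambda>t. f (x + t *\<^sub>R d)) has_real_derivative grad f (x + t *\<^sub>R d) \<bullet> d) (at t)" for t
  proof -
    have "(f has_derivative (\<lambda>h. h \<bullet> grad f (x + t *\<^sub>R d))) (at (x + t *\<^sub>R d))"
      using f by (simp add: continuously_differentiable_def gderiv_def)
    moreover have "((\<lambda>t. x + t *\<^sub>R d) has_derivative (\<lambda>t. t *\<^sub>R d)) (at t)"
      by (auto intro!: derivative_eq_intros)
    ultimately have "((\<lambda>t. f (x + t *\<^sub>R d)) has_derivative
        (\<lambda>s. (s *\<^sub>R d) \<bullet> grad f (x + t *\<^sub>R d))) (at t)"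
      by (rule has_derivative_compose[rotated])
    then show ?thesis
      by (simp add: has_field_derivative_def inner_commute mult_commute_abs)
  qed
  then obtain t where t: "0 < t" "t < 1"
      "f (x + 1 *\<^sub>R d) - f (x + 0 *\<^sub>R d) = (1 - 0) * (grad f (x + t *\<^sub>R d) \<bullet> d)"
    using MVT2[of 0 1 "\<lambda>t. f (x + t *\<^sub>R d)" "\<lambda>t. grad f (x + t *\<^sub>R d) \<bullet> d"] by auto
  have "(grad f (x + t *\<^sub>R d) - grad f x) \<bullet> d \<le> norm (grad f (x + t *\<^sub>R d) - grad f x) * norm d"
    by (rule norm_cauchy_schwarz)
  also have "\<dots> \<le> (L * norm (t *\<^sub>R d)) * norm d"
    using lipschitz_onD[OF L, of "x + t *\<^sub>R d" x]
    by (intro mult_right_mono) (auto simp: dist_norm)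
  also have "\<dots> = t * (L * (norm d)\<^sup>2)"
    using t by (simp add: power2_eq_square)
  also have "\<dots> \<le> 1 * (L * (norm d)\<^sup>2)"
    using t lipschitz_on_nonneg[OF L] by (intro mult_right_mono) auto
  finally show ?thesis
    using t(3) by (simp add: inner_diff_left)
qed

text \<open>The quadratic error of the upper bound is absorbed by the share
  \<open>1 - \<gamma>\<close> of the linear decrease, because
  \<open>- (grad f x \<bullet> d)\<close> dominates the squared norm of \<open>d\<close>. The
  threshold on \<open>\<alpha>\<close> involves neither \<open>x\<close> nor
  \<open>d\<close>.\<close>

lemma Armijo_condition:
  assumes f: "continuously_differentiable f" and L: "L-lipschitz_on UNIV (grad f)"
    and d: "grad f x \<bullet> d \<le> - (norm d)\<^sup>2"
    and \<alpha>: "0 \<le> \<alpha>" "\<alpha> * L \<le> 1 - \<gamma>"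
  shows "f (x + \<alpha> *\<^sub>R d) \<le> f x + \<gamma> * \<alpha> * (grad f x \<bullet> d)"
proof -
  have "\<gamma> \<le> 1"
    using \<alpha> lipschitz_on_nonneg[OF L] by (smt (verit) mult_nonneg_nonneg)
  have "f (x + \<alpha> *\<^sub>R d) \<le> f x + \<alpha> * (grad f x \<bullet> d) + \<alpha> * ((\<alpha> * L) * (norm d)\<^sup>2)"
    using Lipschitz_grad_upper_bound[OF f L, of x "\<alpha> *\<^sub>R d"]
    by (simp add: power_mult_distrib power2_eq_square algebra_simps)
  also have "\<dots> \<le> f x + \<alpha> * (grad f x \<bullet> d) + \<alpha> * ((1 - \<gamma>) * - (grad f x \<bullet> d))"
    using \<alpha> d \<open>\<gamma> \<le> 1\<close> by (intro add_left_mono mult_left_mono mult_mono) auto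
  finally show ?thesis
    by (simp add: algebra_simps)
qed

text \<open>For membership and step length only the form of the step matters, whichever exponent the
  line search selects.\<close>

lemma PGLS_eq:
  obtains i where "PGLS f \<gamma> \<delta> C x = x + \<delta> ^ i *\<^sub>R PG_direction f C x"
  by (rule that) (unfold PGLS_def Let_def, rule refl)

text \<open>A step size in \<open>(0, 1]\<close> makes the new point a convex combination of
  \<open>x\<close> and its projection point, both in \<open>C\<close>.\<close>

lemma PGLS_mem:
  assumes "convex C" "closed C" "x \<in> C" "0 < \<delta>" "\<delta> < 1"
  shows "PGLS f \<gamma> \<delta> C x \<in> C"
proof -
  obtain i where i: "PGLS f \<gamma> \<delta> C x = x + \<delta> ^ i *\<^sub>R PG_direction f C x"
    by (rule PGLS_eq)
  have "closest_point C (x - grad f x) \<in> C"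
    using assms by (intro closest_point_in_set) auto
  moreover have "\<delta> ^ i \<le> 1"
    using assms by (simp add: power_le_one)
  ultimately have "(1 - \<delta> ^ i) *\<^sub>R x + \<delta> ^ i *\<^sub>R closest_point C (x - grad f x) \<in> C"
    using assms by (intro convexD) auto
  then show ?thesis
    unfolding i PG_direction_def by (simp add: algebra_simps)
qed

lemma norm_PGLS_diff_le:
  assumes "0 < \<delta>" "\<delta> < 1"
  shows "norm (PGLS f \<gamma> \<delta> C x - x) \<le> residual f C x"
proof -
  obtain i where "PGLS f \<gamma> \<delta> C x = x + \<delta> ^ i *\<^sub>R PG_direction f C x"
    by (rule PGLS_eq)
  moreover have "\<delta> ^ i \<le> 1"
    using assms by (simp add: power_le_one)
  ultimately show ?thesis
    using assms by (simp add: residual_eq_norm_PG_direction mult_left_le_one_le)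
qed

text \<open>Accepted step sizes have a positive lower bound depending only on the Lipschitz
  constant, \<open>\<gamma>\<close> and \<open>\<delta>\<close>. Hence \<open>c\<close> is fixed
  before \<open>C\<close> and \<open>x\<close>, as required by an algorithm whose set changes from
  one iteration to the next.\<close>

lemma PGLS_sufficient_decrease:
  fixes f :: "'a::euclidean_space \<Rightarrow> real"
  assumes f: "continuously_differentiable f" and L: "\<exists>L. L-lipschitz_on UNIV (grad f)"
    and \<gamma>: "0 < \<gamma>" "\<gamma> < 1" and \<delta>: "0 < \<delta>" "\<delta> < 1"
  obtains c where "c > 0"
    and "\<And>C x. \<lbrakk>convex C; closed C; x \<in> C\<rbrakk>
      \<Longrightarrow> c * (residual f C x)\<^sup>2 \<le> f x - f (PGLS f \<gamma> \<delta> C x)"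
proof -
  from L obtain L0 where "L0-lipschitz_on UNIV (grad f)" by blast
  \<comment> \<open>Enlarging the constant to at least 1 makes it positive, so that division by it
    is possible.\<close>
  then have L1: "(max L0 1)-lipschitz_on UNIV (grad f)"
    by (rule lipschitz_on_le) simp
  define L where "L = max L0 1"
  have L: "L-lipschitz_on UNIV (grad f)" and "L > 0"
    using L1 by (auto simp: L_def)
  \<comment> \<open>Lower bound for the accepted step: either the first trial step 1 passes, or the
    last rejected step exceeded \<open>(1 - \<gamma>) / L\<close> and was multiplied by
    \<open>\<delta>\<close> once more.\<close>
  define a where "a = min 1 (\<delta> * (1 - \<gamma>) / L)"
  have "a > 0"
    using \<gamma> \<delta> \<open>L > 0\<close> by (simp add: a_def)
  show thesis
  proof (rule that[of "\<gamma> * a"])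
    show "\<gamma> * a > 0"
      using \<gamma> \<open>a > 0\<close> by simp
    fix C :: "'a set" and x
    assume C: "convex C" "closed C" "x \<in> C"
    define d where "d = PG_direction f C x"
    have d: "grad f x \<bullet> d \<le> - (norm d)\<^sup>2"
      unfolding d_def by (rule grad_inner_PG_direction_le[OF C])
    define A where "A i \<longleftrightarrow> f (x + \<delta> ^ i *\<^sub>R d) \<le> f x + \<gamma> * \<delta> ^ i * (grad f x \<bullet> d)" for i
    have A: "A i" if "\<delta> ^ i * L \<le> 1 - \<gamma>" for i
      unfolding A_def using \<delta> that by (intro Armijo_condition[OF f L d]) auto
    define j where "j = (LEAST i. A i)"
    \<comment> \<open>Some exponent passes the test, so the line search terminates and
      \<open>LEAST\<close> denotes an exponent satisfying it.\<close>
    obtain i where "\<delta> ^ i < (1 - \<gamma>) / L"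
      using real_arch_pow_inv[of "(1 - \<gamma>) / L" \<delta>] \<gamma> \<delta> \<open>L > 0\<close> by auto
    then have "A i"
      using \<open>L > 0\<close> by (intro A) (simp add: field_simps)
    then have "A j"
      unfolding j_def by (rule LeastI)
    have "a \<le> \<delta> ^ j"
    proof (cases j)
      case 0
      then show ?thesis by (simp add: a_def)
    next
      case (Suc l)
      then have "\<not> A l"
        unfolding j_def by (intro not_less_Least) auto
      then have "1 - \<gamma> < \<delta> ^ l * L"
        using A[of l] by force
      then have "(1 - \<gamma>) / L \<le> \<delta> ^ l"
        using \<open>L > 0\<close> by (simp add: field_simps)
      then have "\<delta> * ((1 - \<gamma>) / L) \<le> \<delta> ^ j"
        unfolding Suc power_Suc using \<delta> by (intro mult_left_mono) auto
      then show ?thesis by (simp add: a_def)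
    qed
    then have "\<gamma> * a * (norm d)\<^sup>2 \<le> \<gamma> * \<delta> ^ j * - (grad f x \<bullet> d)"
      using d \<gamma> \<delta> \<open>a > 0\<close> by (intro mult_mono) auto
    also have "\<dots> \<le> f x - f (x + \<delta> ^ j *\<^sub>R d)"
      using \<open>A j\<close> unfolding A_def by linarith
    also have "x + \<delta> ^ j *\<^sub>R d = PGLS f \<gamma> \<delta> C x"
      by (simp add: PGLS_def Let_def d_def j_def A_def)
    finally show "\<gamma> * a * (residual f C x)\<^sup>2 \<le> f x - f (PGLS f \<gamma> \<delta> C x)"
      by (simp add: residual_eq_norm_PG_direction d_def)
  qed
qed

section \<open>Residual and stationarity\<close>

lemma continuous_on_residual:
  assumes "continuous_on UNIV (grad f)" "convex C" "closed C" "C \<noteq> {}"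
  shows "continuous_on UNIV (residual f C)"
proof -
  have "continuous_on UNIV (\<lambda>x. closest_point C (x - grad f x))"
    using assms
    by (intro continuous_on_compose2[OF continuous_on_closest_point[where t = UNIV]]
        continuous_intros) auto
  then show ?thesis
    unfolding residual_def by (intro continuous_intros)
qed

lemma stationary_iff_residual: "stationary f C x \<longleftrightarrow> x \<in> C \<and> residual f C x = 0"
  by (simp add: stationary_def residual_def)

section \<open>Feasibility of the iterates and outcomes of an iteration\<close>

lemma inner_loop_mem:
  assumes "inner_loop f P res t \<rho> x r" "r = Some z" "x \<in> C" "\<And>u. u \<in> C \<Longrightarrow> P u \<in> C"
  shows "z \<in> C"
  using assms(1-3) by (induction rule: inner_loop.induct) (auto intro: assms(4))

text \<open>The set \<open>W\<close> only shrinks, so its feasibility passes through the induction.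
  The inner loop leaves \<open>y'\<close> unchanged, and its iterates stay in
  \<open>Xset X y'\<close>. The outcome is a variable \<open>r\<close> with an equation so that rule
  induction applies directly.\<close>

lemma local_search_feasible:
  assumes "local_search f X \<gamma> \<delta> t \<rho> W r" "r = Some z" "W \<subseteq> feasible_pairs X s"
    and X: "convex X" "closed X" and \<delta>: "0 < \<delta>" "\<delta> < 1"
  shows "z \<in> feasible_pairs X s"
  using assms(1-3)
proof (induction rule: local_search.induct)
  case (found x' y' W x'')
  then have x': "x' \<in> Xset X y'" and "y' \<in> Yset s"
    by (auto simp: feasible_pairs_def)
  have "x'' \<in> Xset X y'"
    by (rule inner_loop_mem[OF found(2) refl x'])
      (rule PGLS_mem[OF convex_Xset[OF X(1)] closed_Xset[OF X(2)] _ \<delta>])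
  with \<open>y' \<in> Yset s\<close> show ?case
    using found.prems by (auto simp: feasible_pairs_def)
qed auto

lemma SNS_step_feasible:
  assumes step: "SNS_step f X N \<gamma> \<delta> \<xi> \<theta> \<delta>' x y \<eta> \<mu> x1 y1 \<eta>1 \<mu>1"
    and N: "discrete_neighborhood_map X s N"
    and X: "convex X" "closed X" and \<delta>: "0 < \<delta>" "\<delta> < 1"
    and xy: "(x, y) \<in> feasible_pairs X s"
  shows "(x1, y1) \<in> feasible_pairs X s"
proof -
  define xt where "xt = PGLS f \<gamma> \<delta> (Xset X y) x"
  \<comment> \<open>This comes first because \<open>N\<close> is known to have feasible neighbors
    only at feasible pairs.\<close>
  have xt: "(xt, y) \<in> feasible_pairs X s"
    using xy PGLS_mem[OF convex_Xset closed_Xset] X \<delta> by (auto simp: feasible_pairs_def xt_def)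
  obtain r where r: "local_search f X \<gamma> \<delta> (f xt - \<eta>) (residual f (Xset X y) x + \<mu>)
        {(u, v) \<in> N (xt, y). f u \<le> f xt + \<xi>} r"
      "case r of Some (x'', y') \<Rightarrow> x1 = x'' \<and> y1 = y' \<and> \<eta>1 = \<eta>
        | None \<Rightarrow> x1 = xt \<and> y1 = y \<and> \<eta>1 = (if f x1 \<le> f x - \<eta> then \<eta> else \<theta> * \<eta>)"
    using step unfolding SNS_step_def Let_def xt_def by blast
  show ?thesis
  proof (cases r)
    case None
    then show ?thesis using r(2) xt by simp
  next
    case (Some z)
    have "{(u, v) \<in> N (xt, y). f u \<le> f xt + \<xi>} \<subseteq> feasible_pairs X s"
      using N xt by (auto simp: discrete_neighborhood_map_def)
    then have "z \<in> feasible_pairs X s"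
      using local_search_feasible[OF r(1) Some _ X \<delta>] by blast
    then show ?thesis
      using Some r(2) by (cases z) simp
  qed
qed

text \<open>A reduction can occur only in Step 3, after the local search has failed, and only if the
  decrease test fails there. The case \<open>keep\<close> covers both an accepted neighbor and a
  passed test.\<close>

lemma SNS_step_cases:
  assumes "SNS_step f X N \<gamma> \<delta> \<xi> \<theta> \<delta>' x y \<eta> \<mu> x1 y1 \<eta>1 \<mu>1"
  obtains (keep) "\<eta>1 = \<eta>"
  | (reduce) "\<eta>1 = \<theta> * \<eta>" "x1 = PGLS f \<gamma> \<delta> (Xset X y) x" "y1 = y" "f x - f x1 < \<eta>"
proof -
  define xt where "xt = PGLS f \<gamma> \<delta> (Xset X y) x"
  obtain r where r: "case r of Some (x'', y') \<Rightarrow> x1 = x'' \<and> y1 = y' \<and> \<eta>1 = \<eta>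
      | None \<Rightarrow> x1 = xt \<and> y1 = y \<and> \<eta>1 = (if f x1 \<le> f x - \<eta> then \<eta> else \<theta> * \<eta>)"
    using assms unfolding SNS_step_def Let_def xt_def by blast
  show thesis
  proof (cases r)
    case None
    then show ?thesis
      using r keep reduce by (cases "f x1 \<le> f x - \<eta>") (simp_all add: xt_def)
  next
    case (Some z)
    then show ?thesis
      using r keep by (cases z) simp
  qed
qed

section \<open>Vanishing residuals along the reduction indices and passage to the limit\<close>

theorem theorem4p2:
  fixes s :: int and m p :: nat
    and f :: "real^'n \<Rightarrow> real"
    and g h :: "nat \<Rightarrow> real^'n \<Rightarrow> real"
    and X :: "(real^'n) set"
    and N :: "(real^'n) \<times> (real^'n) \<Rightarrow> ((real^'n) \<times> (real^'n)) set"
    and \<gamma> \<delta> \<xi> \<theta> \<delta>' :: real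
    and x y :: "nat \<Rightarrow> real^'n" and \<eta> \<mu> :: "nat \<Rightarrow> real"
    and K\<^sub>u :: "nat set"
    and xs ys :: "real^'n"
  assumes "s < int CARD('n)"
    and "X = constraint_set m g p h"
    and "\<And>i. i \<in> {1..m} \<Longrightarrow> convex_on UNIV (g i) \<and> continuously_differentiable (g i)"
    and "\<And>i. i \<in> {1..p} \<Longrightarrow> affine_fun (h i)"
    and "continuously_differentiable f"
    and "\<exists>L. L-lipschitz_on UNIV (grad f)"
    and "KKT_property f m g p h s"
    and "discrete_neighborhood_map X s N"
    and "neighborhood_continuous X s N"
    and "0 < \<gamma>" "\<gamma> < 1/2" "0 < \<delta>" "\<delta> < 1"
    and "\<xi> > 0" "0 < \<theta>" "\<theta> < 1" "0 < \<delta>'" "\<delta>' < 1"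
    and "y 0 \<in> Yset s" "x 0 \<in> Xset X (y 0)" "\<eta> 0 > 0" "\<mu> 0 > 0"
    and "SNS_sequence f X N \<gamma> \<delta> \<xi> \<theta> \<delta>' x y \<eta> \<mu>"
    and "compact {(u, v). v \<in> Yset s \<and> u \<in> Xset X v \<and> f u \<le> f (x 0) + \<xi>}"
    and "K\<^sub>u = {k. k \<ge> 1 \<and> \<eta> k < \<eta> (k - 1)}"
    and "accumulation_point_along K\<^sub>u (\<lambda>k. (x k, y k)) (xs, ys)"
  shows "\<exists>lam mu gam. KKT_multipliers f m g p h xs ys lam mu gam"
proof -
  note f = \<open>continuously_differentiable f\<close>
  have X: "convex X" "closed X"
    unfolding \<open>X = _\<close> using assms(3,4)
    by (blast intro: convex_constraint_set closed_constraint_set)+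
  have step: "SNS_step f X N \<gamma> \<delta> \<xi> \<theta> \<delta>' (x k) (y k) (\<eta> k) (\<mu> k)
      (x (Suc k)) (y (Suc k)) (\<eta> (Suc k)) (\<mu> (Suc k))" for k
    using \<open>SNS_sequence _ _ _ _ _ _ _ _ _ _ _ _\<close> by (simp add: SNS_sequence_def)
  have feas: "(x k, y k) \<in> feasible_pairs X s" for k
  proof (induction k)
    case 0
    then show ?case
      using \<open>y 0 \<in> Yset s\<close> \<open>x 0 \<in> Xset X (y 0)\<close> by (simp add: feasible_pairs_def)
  next
    case (Suc k)
    then show ?case
      using SNS_step_feasible[OF step] X \<open>discrete_neighborhood_map X s N\<close> \<open>0 < \<delta>\<close> \<open>\<delta> < 1\<close> by blast
  qed
  have \<eta>_pos: "\<eta> k > 0" for k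
  proof (induction k)
    case (Suc k)
    then show ?case
      using \<open>0 < \<theta>\<close> by (cases rule: SNS_step_cases[OF step[of k]]) auto
  qed (fact \<open>\<eta> 0 > 0\<close>)
  have \<eta>_le: "\<eta> (Suc k) \<le> \<eta> k" for k
    using \<open>\<theta> < 1\<close> \<eta>_pos[of k] by (cases rule: SNS_step_cases[OF step[of k]]) auto
  obtain r where r: "strict_mono r" "range r \<subseteq> K\<^sub>u"
      and conv: "pair_converges ((\<lambda>k. (x k, y k)) \<circ> r) (xs, ys)"
    using \<open>accumulation_point_along _ _ _\<close> unfolding accumulation_point_along_def by blast
  have lim_x: "(\<lambda>j. x (r j)) \<longlonglongrightarrow> xs" and ev_y: "\<forall>\<^sub>F j in sequentially. y (r j) = ys"
    using conv by (simp_all add: pair_converges_def o_def)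
  \<comment> \<open>\<open>q j\<close> is the iteration that performs the reduction recorded at
    index \<open>r j\<close>. Members of \<open>K\<^sub>u\<close> are at least 1, so the subtraction
    is not truncated.\<close>
  define q where "q j = r j - 1" for j
  have r_q: "r j = Suc (q j)" and less: "\<eta> (Suc (q j)) < \<eta> (q j)" for j
  proof -
    have "r j \<in> K\<^sub>u" using r(2) by blast
    then show "r j = Suc (q j)" "\<eta> (Suc (q j)) < \<eta> (q j)"
      by (auto simp: \<open>K\<^sub>u = _\<close> q_def)
  qed
  \<comment> \<open>The case \<open>keep\<close> contradicts the strict drop
    \<open>less\<close>.\<close>
  have red: "\<eta> (r j) = \<theta> * \<eta> (q j)" "x (r j) = PGLS f \<gamma> \<delta> (Xset X (y (q j))) (x (q j))"
      "y (r j) = y (q j)" "f (x (q j)) - f (x (r j)) < \<eta> (q j)" for j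
    unfolding r_q using less[of j] by (cases rule: SNS_step_cases[OF step[of "q j"]]; simp)+
  have q: "strict_mono q"
    using r(1) by (auto simp: strict_mono_def r_q)
  have "\<exists>l. \<eta> \<longlonglongrightarrow> l"
  proof -
    have "decseq \<eta>"
      using \<eta>_le by (simp add: decseq_Suc_iff)
    then show ?thesis
      by (rule decseq_convergent[of _ 0]) (use \<eta>_pos less_imp_le in blast)+
  qed
  then obtain l where l: "\<eta> \<longlonglongrightarrow> l" ..
  have lim_\<eta>: "(\<lambda>j. \<eta> (q j)) \<longlonglongrightarrow> l" and "(\<lambda>j. \<eta> (r j)) \<longlonglongrightarrow> l"
    using LIMSEQ_subseq_LIMSEQ[OF l q] LIMSEQ_subseq_LIMSEQ[OF l r(1)] by (simp_all add: o_def)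
  \<comment> \<open>Along \<open>r\<close> and \<open>q\<close> the sequence \<open>\<eta>\<close>
    has the same limit, yet its values differ by the factor \<open>\<theta>\<close>. This forces the
    limit to be 0.\<close>
  moreover have "(\<lambda>j. \<eta> (r j)) \<longlonglongrightarrow> \<theta> * l"
    unfolding red(1) by (intro tendsto_intros lim_\<eta>)
  ultimately have "l = \<theta> * l"
    using LIMSEQ_unique by blast
  then have "l = 0"
    using \<open>\<theta> < 1\<close> by simp
  have C: "convex (Xset X v)" "closed (Xset X v)" for v
    using X by (auto intro: convex_Xset closed_Xset)
  have \<gamma>1: "\<gamma> < 1" using \<open>\<gamma> < 1/2\<close> by simp
  obtain c where c: "c > 0" "\<And>C x. \<lbrakk>convex C; closed C; x \<in> C\<rbrakk>
      \<Longrightarrow> c * (residual f C x)\<^sup>2 \<le> f x - f (PGLS f \<gamma> \<delta> C x)"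
    using PGLS_sufficient_decrease[OF f assms(6) \<open>0 < \<gamma>\<close> \<gamma>1 \<open>0 < \<delta>\<close> \<open>\<delta> < 1\<close>] by metis
  define R where "R j = residual f (Xset X (y (q j))) (x (q j))" for j
  have x_mem: "x k \<in> Xset X (y k)" and y_mem: "y k \<in> Yset s" for k
    using feas[of k] by (auto simp: feasible_pairs_def)
  have "(R j)\<^sup>2 \<le> \<eta> (q j) / c" for j
    using c(2)[OF C x_mem, of "q j"] red(4)[of j] c(1)
    by (simp add: R_def red(2) field_simps)
  then have "\<forall>\<^sub>F j in sequentially. (R j)\<^sup>2 \<le> \<eta> (q j) / c"
    by simp
  moreover have "(\<lambda>j. \<eta> (q j) / c) \<longlonglongrightarrow> 0"
    using tendsto_divide_zero[of "\<lambda>j. \<eta> (q j)"] lim_\<eta> \<open>l = 0\<close> by blast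
  ultimately have "(\<lambda>j. (R j)\<^sup>2) \<longlonglongrightarrow> 0"
    by (rule tendsto_sandwich[OF _ _ tendsto_const, rotated]) simp
  then have lim_R: "R \<longlonglongrightarrow> 0"
    by simp
  \<comment> \<open>The line search step from \<open>x (q j)\<close> is no longer than the residual
    there.\<close>
  have "(\<lambda>j. x (r j) - x (q j)) \<longlonglongrightarrow> 0"
  proof (rule Lim_null_comparison[OF _ lim_R])
    show "\<forall>\<^sub>F j in sequentially. norm (x (r j) - x (q j)) \<le> R j"
      unfolding red(2) R_def
      by (intro always_eventually allI norm_PGLS_diff_le \<open>0 < \<delta>\<close> \<open>\<delta> < 1\<close>)
  qed
  then have lim_xq: "(\<lambda>j. x (q j)) \<longlonglongrightarrow> xs"
    using tendsto_diff[OF lim_x, of "\<lambda>j. x (r j) - x (q j)" 0] by simp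
  \<comment> \<open>A reduction leaves \<open>y\<close> unchanged, so along \<open>q\<close> too the
    discrete component is eventually \<open>ys\<close>. From then on a single set is involved, and
    its closedness and the continuity of its residual can be used.\<close>
  have ev: "\<forall>\<^sub>F j in sequentially. y (q j) = ys"
    using ev_y by (simp add: red(3))
  then have ys: "ys \<in> Yset s"
    using y_mem by (auto simp: eventually_sequentially)
  have xs: "xs \<in> Xset X ys"
  proof (rule Lim_in_closed_set[OF C(2) _ _ lim_xq])
    show "\<forall>\<^sub>F j in sequentially. x (q j) \<in> Xset X ys"
      using ev by eventually_elim (use x_mem in auto)
  qed simp
  have "continuous_on UNIV (residual f (Xset X ys))"
    using f C xs by (intro continuous_on_residual) (auto simp: continuously_differentiable_def)
  then have "(\<lambda>j. residual f (Xset X ys) (x (q j))) \<longlonglongrightarrow> residual f (Xset X ys) xs"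
    using lim_xq by (rule continuous_on_tendsto_compose) auto
  moreover have "(\<lambda>j. residual f (Xset X ys) (x (q j))) \<longlonglongrightarrow> 0"
    \<comment> \<open>\<open>R j\<close> is measured on the varying set
      \<open>Xset X (y (q j))\<close>, which eventually equals \<open>Xset X ys\<close>.\<close>
    by (rule Lim_transform_eventually[OF lim_R])
      (use ev in \<open>eventually_elim, simp add: R_def\<close>)
  ultimately have "residual f (Xset X ys) xs = 0"
    using LIMSEQ_unique by blast
  then have "stationary f (Xset X ys) xs"
    using xs by (simp add: stationary_iff_residual)
  then show ?thesis
    using \<open>KKT_property f m g p h s\<close> xs ys unfolding KKT_property_def \<open>X = _\<close> by blast
qed

end
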